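(* Let $G=(V,E\cup D,z)$ be a signed graph with interaction matrix $W(G)$, and consider threshold networks on $G$ under the parallel update mode. (i) If there exists a threshold vector $b\in\mathbb{Z}^{V}$ such that the threshold network on $G$ with thresholds $b$ admits a total two-cycle, then $\mathcal{S}(G)\ge 0$. (ii) Conversely, if $\mathcal{S}(G)\ge 0$, then there exists a threshold vector $b\in\mathbb{Z}^{V}$ such that the threshold network on $G$ with thresholds $b$ admits an attractor of period $2$.
   Context: A signed graph $G=(V,E\cup D,z)$ consists of a finite vertex set $V$, a set $E$ of undirected edges between distinct vertices (no multiple edges), a set $D$ of self-loops (at most one per vertex), and a sign map $z:E\cup D\to\{-1,+1\}$. Write $n=|V|$, $m=|E|$, and $d^{+}$ (resp. $d^{-}$) for the number of positive (resp. negative) self-loops. The interaction matrix $W(G)=(w_{ij})$ is symmetric with $w_{ij}=z(\{i,j\})$ if $\{i,j\}\in E$, $w_{ii}$ the sign of the loop at $i$ if present, and $0$ otherwise. The sign of a cycle of $(V,E)$ is the product of its edge signs; $G$ is antibalanced if every even cycle of $(V,E)$ is positive and every odd cycle is negative. $\rho(G)$ is the minimum size of $X\subseteq E$ such that the graph with edge set $E\setminus X$ is antibalanced. The stability index is $\mathcal{S}(G)=-n-d^{+}+d^{-}+2m-4\rho(G)$. The threshold network with thresholds $b$ has local functions $f_i(x)=1$ if $\sum_{j\in V}w_{ij}x_j-b_i>0$, $f_i(x)=x_i$ if this quantity is $0$, $f_i(x)=-1$ otherwise ($x\in\{-1,1\}^V$), and parallel map $f=(f_i)_{i\in V}$. An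 attractor of period $p$ is a configuration $x$ with $f^p(x)=x$ and $p\ge 1$ minimal. A total two-cycle is a configuration $x$ with $f(f(x))=x$ and $f(x)_i\neq x_i$ for every $i\in V$. *)

theory Defs
  imports Main "HOL-Library.FuncSet"
begin

text \<open>A self-loop at \<open>i\<close> is the singleton \<open>{i}\<close> and an undirected edge is a two-element set, so
  \<open>E\<close> and \<open>D\<close> are disjoint and one sign map covers \<open>E \<union> D\<close>; its values elsewhere are never
  used.\<close>

record 'v sgraph =
  verts :: "'v set"
  edges :: "'v set set"
  loops :: "'v set set"
  sign :: "'v set \<Rightarrow> int"

definition signed_graph :: "'v sgraph \<Rightarrow> bool" where
  "signed_graph G \<longleftrightarrow>
     finite (verts G) \<and>
     edges G \<subseteq> {e. e \<subseteq> verts G \<and> card e = 2} \<and>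
     loops G \<subseteq> {{i} | i. i \<in> verts G} \<and>
     sign G \<in> edges G \<union> loops G \<rightarrow> {-1, 1}"

text \<open>For \<open>i = j\<close> the set \<open>{i, j}\<close> is the loop \<open>{i}\<close>, so the diagonal entries are covered as well.\<close>

definition interaction_matrix :: "'v sgraph \<Rightarrow> 'v \<Rightarrow> 'v \<Rightarrow> int" where
  "interaction_matrix G i j = (if {i, j} \<in> edges G \<union> loops G then sign G {i, j} else 0)"

text \<open>A cycle is given by the list of its (distinct) vertices in cyclic order; its number of edges is
  the length of the list.\<close>

definition cycle_edge :: "'v list \<Rightarrow> nat \<Rightarrow> 'v set" where
  "cycle_edge c k = {c ! k, c ! (Suc k mod length c)}"

definition is_cycle :: "'v set set \<Rightarrow> 'v list \<Rightarrow> bool" where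
  "is_cycle E c \<longleftrightarrow> 3 \<le> length c \<and> distinct c \<and> (\<forall>k<length c. cycle_edge c k \<in> E)"

definition cycle_sign :: "('v set \<Rightarrow> int) \<Rightarrow> 'v list \<Rightarrow> int" where
  "cycle_sign z c = (\<Prod>k<length c. z (cycle_edge c k))"

definition antibalanced :: "'v set set \<Rightarrow> ('v set \<Rightarrow> int) \<Rightarrow> bool" where
  "antibalanced E z \<longleftrightarrow>
     (\<forall>c. is_cycle E c \<longrightarrow> cycle_sign z c = (if even (length c) then 1 else -1))"

text \<open>The set under \<open>Min\<close> is finite when \<open>edges G\<close> is, and it is nonempty because removing all
  edges leaves no cycle.\<close>

definition rho :: "'v sgraph \<Rightarrow> nat" where
  "rho G = Min (card ` {X. X \<subseteq> edges G \<and> antibalanced (edges G - X) (sign G)})"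

definition pos_loops :: "'v sgraph \<Rightarrow> nat" where
  "pos_loops G = card {l \<in> loops G. sign G l = 1}"

definition neg_loops :: "'v sgraph \<Rightarrow> nat" where
  "neg_loops G = card {l \<in> loops G. sign G l = -1}"

definition stability_index :: "'v sgraph \<Rightarrow> int" where
  "stability_index G =
     - int (card (verts G)) - int (pos_loops G) + int (neg_loops G)
     + 2 * int (card (edges G)) - 4 * int (rho G)"

text \<open>Configurations take the value \<open>undefined\<close> outside \<open>verts G\<close>, so that equality of
  configurations is equality on \<open>verts G\<close>.\<close>

definition configs :: "'v sgraph \<Rightarrow> ('v \<Rightarrow> int) set" where
  "configs G = (verts G \<rightarrow>\<^sub>E {-1, 1})"

definition local_fun :: "'v sgraph \<Rightarrow> ('v \<Rightarrow> int) \<Rightarrow> 'v \<Rightarrow> ('v \<Rightarrow> int) \<Rightarrow> int" where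
  "local_fun G b i x =
     (let s = (\<Sum>j\<in>verts G. interaction_matrix G i j * x j) - b i
      in if s > 0 then 1 else if s = 0 then x i else -1)"

definition parallel_map :: "'v sgraph \<Rightarrow> ('v \<Rightarrow> int) \<Rightarrow> ('v \<Rightarrow> int) \<Rightarrow> ('v \<Rightarrow> int)" where
  "parallel_map G b x = (\<lambda>i\<in>verts G. local_fun G b i x)"

definition attractor :: "'v sgraph \<Rightarrow> ('v \<Rightarrow> int) \<Rightarrow> nat \<Rightarrow> ('v \<Rightarrow> int) \<Rightarrow> bool" where
  "attractor G b p x \<longleftrightarrow>
     x \<in> configs G \<and> 1 \<le> p \<and> (parallel_map G b ^^ p) x = x \<and>
     (\<forall>q. 1 \<le> q \<and> q < p \<longrightarrow> (parallel_map G b ^^ q) x \<noteq> x)"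

definition total_two_cycle :: "'v sgraph \<Rightarrow> ('v \<Rightarrow> int) \<Rightarrow> ('v \<Rightarrow> int) \<Rightarrow> bool" where
  "total_two_cycle G b x \<longleftrightarrow>
     x \<in> configs G \<and> parallel_map G b (parallel_map G b x) = x \<and>
     (\<forall>i\<in>verts G. parallel_map G b x i \<noteq> x i)"

end

theory Submission
  imports Defs
begin

text \<open>
  Write \<open>q(x) = \<Sum>\<^sub>i\<^sub>j w\<^sub>i\<^sub>j x\<^sub>i x\<^sub>j\<close>. For \<open>x \<in> {-1, 1}\<^sup>V\<close> one has \<open>q(x) = d\<^sup>+ - d\<^sup>- - 2 m + 4 |X|\<close>, where
  \<open>X\<close> is the set of edges \<open>ij\<close> with \<open>z(ij) x\<^sub>i x\<^sub>j = 1\<close>. By Harary's argument, a graph is antibalanced iff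
  some \<open>x\<close> has \<open>z(ij) x\<^sub>i x\<^sub>j = -1\<close> on every edge, so the minimum of \<open>q\<close> is \<open>-n - \<S>(G)\<close>.
  A total two-cycle \<open>x\<close> has \<open>x\<^sub>i (W x)\<^sub>i \<le> -1\<close> for all \<open>i\<close>, hence \<open>q(x) \<le> -n\<close> and \<open>\<S>(G) \<ge> 0\<close>.
  Conversely, take \<open>x\<close> with \<open>q(x) \<le> -n\<close>. Deleting a vertex with \<open>x\<^sub>i (W x)\<^sub>i \<ge> 0\<close> decreases
  \<open>n\<close> by one and increases \<open>q\<close> by at most \<open>w\<^sub>i\<^sub>i \<le> 1\<close>, so repeated deletion preserves the bound and
  stops at a nonempty set \<open>S\<close> on which all these products are negative. Thresholds that freeze the
  vertices outside \<open>S\<close> and compensate their influence on \<open>S\<close> make \<open>S\<close> blink.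
\<close>

section \<open>Harary's characterisation of antibalanced graphs\<close>

text \<open>Every interior vertex of the path lies on two of its edges, so its factors square to 1;
  only the two ends and one factor -1 per edge remain.\<close>

lemma prod_edges_path:
  fixes x :: "'v \<Rightarrow> int"
  assumes "\<And>k. k < m \<Longrightarrow> z {p ! k, p ! Suc k} = - (x (p ! k) * x (p ! Suc k))"
    and "\<And>v. x v \<in> {-1, 1}"
  shows "(\<Prod>k<m. z {p ! k, p ! Suc k}) = (-1) ^ m * (x (p ! 0) * x (p ! m))"
  using assms(1)
proof (induction m)
  case 0
  then show ?case using assms(2)[of "p ! 0"] by auto
next
  case (Suc m)
  have "x (p ! m) * x (p ! m) = 1" using assms(2)[of "p ! m"] by auto
  then have "x (p ! 0) * x (p ! m) * (x (p ! m) * x (p ! Suc m)) = x (p ! 0) * x (p ! Suc m)"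
    by (metis mult.assoc mult.left_neutral)
  with Suc show ?case by simp
qed

lemma cycle_sign_path:
  assumes "c \<noteq> []"
  shows "cycle_sign z c =
    (\<Prod>k<length c - 1. z {c ! k, c ! Suc k}) * z {c ! (length c - 1), c ! 0}"
proof -
  obtain m where m: "length c = Suc m" using assms by (cases c) auto
  have "(\<Prod>k<m. z (cycle_edge c k)) = (\<Prod>k<m. z {c ! k, c ! Suc k})"
    by (rule prod.cong) (auto simp: cycle_edge_def m)
  then show ?thesis by (simp add: cycle_sign_def m) (simp add: cycle_edge_def m)
qed

lemma prod_pair:
  assumes "card {u, v} = 2"
  shows "prod x {u, v} = (x u :: int) * x v"
  using assms by (cases "u = v") auto

text \<open>Around a cycle every vertex value occurs twice and cancels, which leaves one factor -1
  per edge, exactly the sign that antibalance demands.\<close>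

lemma antibalanced_if_switching:
  fixes x :: "'v \<Rightarrow> int"
  assumes two: "\<And>e. e \<in> F \<Longrightarrow> card e = 2"
    and sw: "\<And>e. e \<in> F \<Longrightarrow> z e = - prod x e"
    and x: "\<And>v. x v \<in> {-1, 1}"
  shows "antibalanced F z"
  unfolding antibalanced_def
proof (intro allI impI)
  fix c assume c: "is_cycle F c"
  obtain m where m: "length c = Suc m" using c by (cases c) (auto simp: is_cycle_def)
  have sw': "z {u, v} = - (x u * x v)" if "{u, v} \<in> F" for u v
    using sw[OF that] prod_pair[OF two[OF that]] by simp
  have edge: "cycle_edge c k \<in> F" if "k < Suc m" for k
    using c that m by (auto simp: is_cycle_def)
  have inner: "{c ! k, c ! Suc k} \<in> F" if "k < m" for k
    using edge[of k] that by (simp add: cycle_edge_def m)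
  have last: "{c ! m, c ! 0} \<in> F"
    using edge[of m] by (simp add: cycle_edge_def m)
  have "c \<noteq> []" using m by auto
  then have "cycle_sign z c = (-1) ^ m * (x (c ! 0) * x (c ! m)) * - (x (c ! m) * x (c ! 0))"
    using prod_edges_path[of m z c x, OF sw'[OF inner] x] sw'[OF last]
    by (simp add: cycle_sign_path m)
  also have "\<dots> = (-1) ^ Suc m"
    using x[of "c ! 0"] x[of "c ! m"] by auto
  finally show "cycle_sign z c = (if even (length c) then 1 else -1)"
    by (simp add: m)
qed

text \<open>The vertex set of the component of \<open>u\<close>. It is described by simple paths so
  that an edge back to \<open>u\<close> closes such a path to a vertex list with distinct entries,
  as \<open>is_cycle\<close> demands.\<close>

definition reach :: "'v set set \<Rightarrow> 'v \<Rightarrow> 'v set" where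
  "reach F u = {w. \<exists>p. p \<noteq> [] \<and> distinct p \<and> hd p = u \<and> last p = w \<and>
     (\<forall>k. Suc k < length p \<longrightarrow> {p ! k, p ! Suc k} \<in> F)}"

lemma reach_refl: "u \<in> reach F u"
  unfolding reach_def by (rule CollectI, rule exI[of _ "[u]"]) simp

lemma reach_step:
  assumes "v \<in> reach F u" "{v, w} \<in> F"
  shows "w \<in> reach F u"
proof -
  obtain p where p: "p \<noteq> []" "distinct p" "hd p = u" "last p = v"
    and e: "\<And>k. Suc k < length p \<Longrightarrow> {p ! k, p ! Suc k} \<in> F"
    using assms(1) unfolding reach_def by blast
  show ?thesis
  proof (cases "w \<in> set p")
    case True
    then obtain k where k: "k < length p" "p ! k = w" by (auto simp: in_set_conv_nth)
    \<comment> \<open>Here \<open>w\<close> already lies on the path, and cutting the path at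
      \<open>w\<close> keeps it simple.\<close>
    let ?q = "take (Suc k) p"
    have "last ?q = w" using k by (simp add: take_Suc_conv_app_nth)
    moreover have "?q \<noteq> []" "distinct ?q" "hd ?q = u" using p by auto
    moreover have "\<forall>j. Suc j < length ?q \<longrightarrow> {?q ! j, ?q ! Suc j} \<in> F"
      using e by auto
    ultimately show ?thesis unfolding reach_def by blast
  next
    case False
    let ?q = "p @ [w]"
    have "{?q ! j, ?q ! Suc j} \<in> F" if "Suc j < length ?q" for j
    proof (cases "Suc j < length p")
      case True
      then show ?thesis using e[of j] by (simp add: nth_append)
    next
      case False
      then have "j = length p - 1" "Suc j = length p" using that by auto
      then show ?thesis using p assms(2) by (simp add: nth_append last_conv_nth)
    qed
    moreover have "?q \<noteq> []" "distinct ?q" "hd ?q = u" "last ?q = w" using p False by auto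
    ultimately show ?thesis unfolding reach_def by blast
  qed
qed

text \<open>The edge closes a simple path in \<open>F\<close> to a cycle. Antibalance fixes the sign
  of the cycle and \<open>x\<close> that of the path, so the sign of the edge is forced.\<close>

lemma sign_of_closing_edge:
  fixes x :: "'v \<Rightarrow> int"
  assumes v: "v \<in> reach F u" and "u \<noteq> v" "{u, v} \<notin> F"
    and two: "\<And>e. e \<in> F \<Longrightarrow> card e = 2"
    and sw: "\<And>e. e \<in> F \<Longrightarrow> z e = - prod x e"
    and x: "\<And>v. x v \<in> {-1, 1}"
    and anti: "antibalanced (insert {u, v} F) z"
  shows "z {u, v} = - (x u * x v)"
proof -
  obtain p where p: "p \<noteq> []" "distinct p" "hd p = u" "last p = v"
    and e: "\<And>k. Suc k < length p \<Longrightarrow> {p ! k, p ! Suc k} \<in> F"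
    using v unfolding reach_def by blast
  obtain m where m: "length p = Suc m" using p(1) by (cases p) auto
  have p0: "p ! 0 = u" and pm: "p ! m = v"
    using p m by (auto simp: hd_conv_nth last_conv_nth)
  \<comment> \<open>A cycle needs at least two path edges; fewer would mean \<open>u = v\<close> or
    \<open>{u, v}\<close> in \<open>F\<close>.\<close>
  have "m \<noteq> 0" using p0 pm \<open>u \<noteq> v\<close> by metis
  moreover have "m \<noteq> 1" using p0 pm e[of 0] m \<open>{u, v} \<notin> F\<close> by auto
  ultimately have m2: "m \<ge> 2" by auto
  have "cycle_edge p k \<in> insert {u, v} F" if "k < Suc m" for k
    using that e[of k] p0 pm m by (cases "k = m") (auto simp: cycle_edge_def)
  then have "is_cycle (insert {u, v} F) p"
    using m2 m p(2) by (simp add: is_cycle_def)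
  then have "cycle_sign z p = (-1) ^ Suc m"
    using anti m by (auto simp: antibalanced_def)
  moreover have "z {p ! k, p ! Suc k} = - (x (p ! k) * x (p ! Suc k))" if "k < m" for k
    using sw[OF e] prod_pair[OF two[OF e]] that m by simp
  then have "cycle_sign z p = (-1) ^ m * (x u * x v) * z {u, v}"
    using prod_edges_path[of m z p x] x p(1)
    by (simp add: cycle_sign_path m p0 pm insert_commute)
  ultimately have "x u * x v * z {u, v} = -1"
    by (cases "even m") auto
  then show ?thesis using x[of u] x[of v] by auto
qed

text \<open>Induction on the edges. If the new edge violates the switching, its ends lie in
  different components of the old graph by \<open>sign_of_closing_edge\<close>; negating
  \<open>x\<close> on one component repairs it and changes no product along an old edge.\<close>

lemma switching_if_antibalanced:
  fixes z :: "'v set \<Rightarrow> int"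
  assumes "finite F"
    and "\<And>e. e \<in> F \<Longrightarrow> card e = 2"
    and "\<And>e. e \<in> F \<Longrightarrow> z e \<in> {-1, 1}"
    and "antibalanced F z"
  shows "\<exists>x :: 'v \<Rightarrow> int. (\<forall>v. x v \<in> {-1, 1}) \<and> (\<forall>e\<in>F. z e = - prod x e)"
  using assms
proof (induction F rule: finite_induct)
  case empty
  show ?case by (rule exI[of _ "\<lambda>_. 1"]) simp
next
  case (insert e F)
  obtain u v where uv: "e = {u, v}" "u \<noteq> v"
    using insert.prems(1)[of e] by (auto simp: card_2_iff)
  have "antibalanced F z"
    using insert.prems(3) by (auto simp: antibalanced_def is_cycle_def)
  then obtain x :: "'v \<Rightarrow> int" where x: "\<And>v. x v \<in> {-1, 1}"
    and sw: "\<And>e. e \<in> F \<Longrightarrow> z e = - prod x e"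
    using insert by (metis insertI2)
  have two: "\<And>e. e \<in> F \<Longrightarrow> card e = 2" using insert.prems(1) by blast
  have pe: "prod y e = y u * y v" for y :: "'v \<Rightarrow> int" using uv by simp
  show ?case
  proof (cases "z e = - (x u * x v)")
    case True
    then show ?thesis using x sw pe by (intro exI[of _ x]) auto
  next
    case False
    then have v: "v \<notin> reach F u"
      using sign_of_closing_edge[of v F u z x] uv insert.hyps(2) two sw x insert.prems(3)
      by blast
    let ?y = "\<lambda>w. if w \<in> reach F u then - x w else x w"
    have y: "\<forall>w. ?y w \<in> {-1, 1}" using x by auto
    have "z f = - prod ?y f" if f: "f \<in> F" for f
    proof -
      obtain a b where ab: "f = {a, b}" "a \<noteq> b" using two[OF f] by (auto simp: card_2_iff)
      have "a \<in> reach F u \<longleftrightarrow> b \<in> reach F u"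
        using reach_step[of a F u b] reach_step[of b F u a] f ab by (auto simp: insert_commute)
      then have "prod ?y f = prod x f" using ab by auto
      then show ?thesis using sw[OF f] by simp
    qed
    moreover have "z e = x u * x v"
      using False insert.prems(2)[of e] x[of u] x[of v] by auto
    then have "z e = - prod ?y e" using v by (simp add: pe reach_refl)
    ultimately show ?thesis using y by (intro exI[of _ ?y]) blast
  qed
qed

section \<open>The quadratic form of a signed graph\<close>

lemma sum_signs:
  fixes t :: "'a \<Rightarrow> int"
  assumes "finite A" "\<And>a. a \<in> A \<Longrightarrow> t a \<in> {-1, 1}"
  shows "sum t A = int (card {a \<in> A. t a = 1}) - int (card {a \<in> A. t a = -1})"
proof -
  have "sum t A = (\<Sum>a\<in>A. of_bool (t a = 1) - of_bool (t a = -1))"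
    using assms(2) by (intro sum.cong) auto
  also have "\<dots> = int (card {a \<in> A. t a = 1}) - int (card {a \<in> A. t a = -1})"
    using assms(1) by (simp add: sum_subtractf Int_def)
  finally show ?thesis .
qed

lemma sum_signs':
  fixes t :: "'a \<Rightarrow> int"
  assumes "finite A" "\<And>a. a \<in> A \<Longrightarrow> t a \<in> {-1, 1}"
  shows "sum t A = 2 * int (card {a \<in> A. t a = 1}) - int (card A)"
proof -
  have "card A = card ({a \<in> A. t a = 1} \<union> {a \<in> A. t a = -1})"
    using assms(2) by (intro arg_cong[of _ _ card]) auto
  also have "\<dots> = card {a \<in> A. t a = 1} + card {a \<in> A. t a = -1}"
    using assms(1) by (intro card_Un_disjoint) auto
  finally show ?thesis using sum_signs[OF assms] by simp
qed

lemma sum_ordered_pairs: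
  fixes g :: "'v set \<Rightarrow> int"
  assumes "finite V" and E: "E \<subseteq> {e. e \<subseteq> V \<and> card e = 2}"
  shows "(\<Sum>i\<in>V. \<Sum>j\<in>V. if {i, j} \<in> E then g {i, j} else 0) = 2 * sum g E"
proof -
  let ?P = "{q \<in> V \<times> V. {fst q, snd q} \<in> E}"
  have finE: "finite E"
    using finite_subset[of E "Pow V"] assms by auto
  have "(\<Sum>i\<in>V. \<Sum>j\<in>V. if {i, j} \<in> E then g {i, j} else 0)
      = (\<Sum>q\<in>V \<times> V. if {fst q, snd q} \<in> E then g {fst q, snd q} else 0)"
    by (simp add: sum.cartesian_product case_prod_beta)
  also have "\<dots> = (\<Sum>q\<in>?P. g {fst q, snd q})"
    using assms(1) by (subst sum.inter_filter) auto
  \<comment> \<open>Grouping by the underlying edge: each group consists of the two orientations of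
    one edge.\<close>
  also have "\<dots> = (\<Sum>e\<in>E. \<Sum>q\<in>{q \<in> ?P. {fst q, snd q} = e}. g {fst q, snd q})"
    using assms(1) finE by (subst sum.group) auto
  also have "\<dots> = (\<Sum>e\<in>E. 2 * g e)"
  proof (rule sum.cong[OF refl])
    fix e assume e: "e \<in> E"
    then obtain u v where uv: "e = {u, v}" "u \<noteq> v" "u \<in> V" "v \<in> V"
      using E by (auto simp: card_2_iff)
    have "{q \<in> ?P. {fst q, snd q} = e} = {(u, v), (v, u)}"
    proof (rule set_eqI)
      fix q :: "'v \<times> 'v"
      have "fst q \<in> V \<and> snd q \<in> V" if "{fst q, snd q} = e"
        using that uv by (metis insertCI insert_subset singletonD subset_insertI insertE)
      then have "q \<in> {q \<in> ?P. {fst q, snd q} = e} \<longleftrightarrow> {fst q, snd q} = {u, v}"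
        using e uv(1) by (cases q) force
      then show "q \<in> {q \<in> ?P. {fst q, snd q} = e} \<longleftrightarrow> q \<in> {(u, v), (v, u)}"
        by (simp only: doubleton_eq_iff insert_iff empty_iff prod_eq_iff fst_conv snd_conv simp_thms)
    qed
    then show "(\<Sum>q\<in>{q \<in> ?P. {fst q, snd q} = e}. g {fst q, snd q}) = 2 * g e"
      using uv by (simp add: insert_commute)
  qed
  finally show ?thesis by (simp add: sum_distrib_left)
qed

section \<open>Deleting vertices until all row sums are negative\<close>

lemma negative_row_subset:
  fixes a :: "'v \<Rightarrow> 'v \<Rightarrow> int"
  assumes "finite T" "T \<noteq> {}"
    and sym: "\<And>i j. a i j = a j i" and diag: "\<And>i. a i i \<le> 1"
    and "(\<Sum>i\<in>T. \<Sum>j\<in>T. a i j) \<le> - int (card T)"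
  shows "\<exists>S\<subseteq>T. S \<noteq> {} \<and> (\<forall>i\<in>S. (\<Sum>j\<in>S. a i j) < 0)"
  using assms(1,2,5)
proof (induction T rule: finite_psubset_induct)
  case (psubset T)
  show ?case
  proof (cases "\<forall>i\<in>T. (\<Sum>j\<in>T. a i j) < 0")
    case True
    then show ?thesis using psubset.prems by blast
  next
    case False
    then obtain i where i: "i \<in> T" "(\<Sum>j\<in>T. a i j) \<ge> 0" by (auto simp: not_less)
    let ?U = "T - {i}"
    have row: "(\<Sum>j\<in>T. a k j) = a k i + (\<Sum>j\<in>?U. a k j)" for k
      by (rule sum.remove) (use psubset.hyps i in auto)
    have "(\<Sum>k\<in>T. \<Sum>j\<in>T. a k j) = (\<Sum>j\<in>T. a i j) + (\<Sum>k\<in>?U. \<Sum>j\<in>T. a k j)"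
      by (rule sum.remove) (use psubset.hyps i in auto)
    \<comment> \<open>By symmetry the column of \<open>i\<close> repeats its row, so deleting
      \<open>i\<close> removes twice the row sum less \<open>a i i\<close>.\<close>
    also have "(\<Sum>k\<in>?U. \<Sum>j\<in>T. a k j) = (\<Sum>k\<in>?U. a i k) + (\<Sum>k\<in>?U. \<Sum>j\<in>?U. a k j)"
      unfolding row sum.distrib by (simp only: sym[of i])
    also have "(\<Sum>k\<in>?U. a i k) = (\<Sum>j\<in>T. a i j) - a i i" using row[of i] by simp
    finally have bound: "(\<Sum>k\<in>?U. \<Sum>j\<in>?U. a k j) \<le> - int (card T) + 1"
      using psubset.prems i(2) diag[of i] by linarith
    have card: "card T = Suc (card ?U)" by (rule card.remove) (use psubset.hyps i in auto)
    \<comment> \<open>For a singleton the row sum is the whole double sum, hence at most -1, against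
      the choice of \<open>i\<close>; so deletion never exhausts the set.\<close>
    have "?U \<noteq> {}"
    proof
      assume "?U = {}"
      then have "T = {i}" using i by blast
      then show False using psubset.prems i(2) by simp
    qed
    moreover have "?U \<subset> T" using i by blast
    moreover have "(\<Sum>k\<in>?U. \<Sum>j\<in>?U. a k j) \<le> - int (card ?U)" using bound card by simp
    ultimately obtain S where "S \<subseteq> ?U" "S \<noteq> {}" "\<forall>i\<in>S. (\<Sum>j\<in>S. a i j) < 0"
      using psubset.IH[of ?U] by blast
    then show ?thesis by blast
  qed
qed

context
  fixes G :: "'v sgraph"
  assumes sg: "signed_graph G"
begin

abbreviation (input) "V \<equiv> verts G"
abbreviation (input) "E \<equiv> edges G"
abbreviation (input) "z \<equiv> sign G"
abbreviation (input) "w \<equiv> interaction_matrix G"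

lemma finV: "finite V"
  and E_sub: "E \<subseteq> {e. e \<subseteq> V \<and> card e = 2}"
  and loops_sub: "loops G \<subseteq> {{i} | i. i \<in> V}"
  and z_sign: "e \<in> E \<union> loops G \<Longrightarrow> z e \<in> {-1, 1}"
  using sg by (auto simp: signed_graph_def)

lemma finE: "finite E"
  using finite_subset[of E "Pow V"] finV E_sub by auto

lemma w_sym: "w i j = w j i"
  by (simp add: interaction_matrix_def insert_commute)

lemma w_le_1: "w i j \<le> 1"
  using z_sign[of "{i, j}"] by (auto simp: interaction_matrix_def)

lemma sum_loops: "(\<Sum>i\<in>V. if {i} \<in> loops G then z {i} else 0)
  = int (pos_loops G) - int (neg_loops G)"
proof -
  have loops: "loops G = (\<lambda>i. {i}) ` {i \<in> V. {i} \<in> loops G}"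
    using loops_sub by auto
  have "(\<Sum>i\<in>V. if {i} \<in> loops G then z {i} else 0) = (\<Sum>i\<in>{i \<in> V. {i} \<in> loops G}. z {i})"
    using finV by (subst sum.inter_filter) auto
  also have "\<dots> = sum z (loops G)"
    by (subst (2) loops, subst sum.reindex) auto
  also have "\<dots> = int (pos_loops G) - int (neg_loops G)"
    unfolding pos_loops_def neg_loops_def
  proof (rule sum_signs)
    show "finite (loops G)" by (subst loops) (use finV in auto)
  qed (use z_sign in auto)
  finally show ?thesis .
qed

text \<open>The squares x_i^2 = 1 make the loops contribute independently of \<open>x\<close>. Each
  edge is counted in both orientations, which together with \<open>sum_signs'\<close> gives the
  factors 2 and 4.\<close>

lemma quadratic_form:
  fixes x :: "'v \<Rightarrow> int"
  assumes x: "\<And>v. x v \<in> {-1, 1}"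
  shows "(\<Sum>i\<in>V. \<Sum>j\<in>V. x i * w i j * x j) =
    int (pos_loops G) - int (neg_loops G) - 2 * int (card E)
      + 4 * int (card {e \<in> E. z e * prod x e = 1})"
proof -
  have sq: "x i * x i = 1" for i using x[of i] by auto
  have "x i * w i j * x j = (if {i, j} \<in> E then z {i, j} * prod x {i, j} else 0)
      + (if i = j then if {i} \<in> loops G then z {i} else 0 else 0)" for i j
  proof (cases "i = j")
    case True
    have "{i} \<notin> E" using E_sub by auto
    then show ?thesis using True sq[of i] by (auto simp: interaction_matrix_def)
  next
    case False
    then have "{i, j} \<notin> loops G" using loops_sub by auto
    then show ?thesis using False by (auto simp: interaction_matrix_def)
  qed
  then have "(\<Sum>i\<in>V. \<Sum>j\<in>V. x i * w i j * x j) =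
      2 * (\<Sum>e\<in>E. z e * prod x e) + (\<Sum>i\<in>V. if {i} \<in> loops G then z {i} else 0)"
    using sum_ordered_pairs[OF finV E_sub, of "\<lambda>e. z e * prod x e"] finV
    by (simp add: sum.distrib)
  moreover have "(\<Sum>e\<in>E. z e * prod x e) =
      2 * int (card {e \<in> E. z e * prod x e = 1}) - int (card E)"
  proof (rule sum_signs'[OF finE])
    fix e assume e: "e \<in> E"
    then obtain u v where "e = {u, v}" "u \<noteq> v" using E_sub by (auto simp: card_2_iff)
    then show "z e * prod x e \<in> {-1, 1}" using z_sign[of e] e x[of u] x[of v] by auto
  qed
  ultimately show ?thesis by (simp add: sum_loops)
qed

section \<open>The number \<open>rho\<close> as a minimum over switchings\<close>

abbreviation (input) "antibalancing_sets \<equiv> {X. X \<subseteq> E \<and> antibalanced (E - X) z}"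

lemma finite_antibalancing: "finite antibalancing_sets"
  by (rule finite_subset[of _ "Pow E"]) (use finE in auto)

lemma rho_le:
  fixes x :: "'v \<Rightarrow> int"
  assumes x: "\<And>v. x v \<in> {-1, 1}"
  shows "rho G \<le> card {e \<in> E. z e * prod x e = 1}"
proof -
  let ?X = "{e \<in> E. z e * prod x e = 1}"
  have "antibalanced (E - ?X) z"
  proof (rule antibalanced_if_switching[OF _ _ x])
    fix e assume e: "e \<in> E - ?X"
    show "card e = 2" using e E_sub by auto
    then obtain u v where "e = {u, v}" "u \<noteq> v" by (auto simp: card_2_iff)
    then show "z e = - prod x e" using z_sign[of e] e x[of u] x[of v] by auto
  qed
  then have "?X \<in> antibalancing_sets" by simp
  then show ?thesis
    unfolding rho_def using finite_antibalancing by (intro Min_le) blast+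
qed

text \<open>A switching of the graph left by an optimal removal can fail only on removed
  edges.\<close>

lemma rho_attained:
  obtains x :: "'v \<Rightarrow> int" where "\<And>v. x v \<in> {-1, 1}"
    and "card {e \<in> E. z e * prod x e = 1} \<le> rho G"
proof -
  have "E \<in> antibalancing_sets" by (force simp: antibalanced_def is_cycle_def)
  then have "rho G \<in> card ` antibalancing_sets"
    unfolding rho_def using finite_antibalancing by (intro Min_in) blast+
  then obtain X where X: "rho G = card X" "X \<subseteq> E" "antibalanced (E - X) z" by auto
  have "\<exists>x :: 'v \<Rightarrow> int. (\<forall>v. x v \<in> {-1, 1}) \<and> (\<forall>e\<in>E - X. z e = - prod x e)"
    using finE E_sub z_sign X(3) by (intro switching_if_antibalanced) auto
  then obtain x :: "'v \<Rightarrow> int" where x: "\<And>v. x v \<in> {-1, 1}"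
    and sw: "\<And>e. e \<in> E - X \<Longrightarrow> z e = - prod x e" by blast
  have "z e * prod x e \<noteq> 1" if e: "e \<in> E - X" for e
  proof -
    have "z e * prod x e = - (z e * z e)" using sw[OF e] by simp
    then show ?thesis using z_sign[of e] e by auto
  qed
  then have "{e \<in> E. z e * prod x e = 1} \<subseteq> X" by blast
  then have "card {e \<in> E. z e * prod x e = 1} \<le> rho G"
    unfolding X(1) using X(2) finE by (intro card_mono) (auto dest: finite_subset)
  with x that show ?thesis by blast
qed

section \<open>Two-cycles of the parallel dynamics\<close>

lemma parallel_map_eq:
  assumes "i \<in> V"
  shows "parallel_map G b x i = (let s = (\<Sum>j\<in>V. w i j * x j) - b i
    in if s > 0 then 1 else if s = 0 then x i else -1)"
  using assms by (simp add: parallel_map_def local_fun_def)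

lemma stability_if_total_two_cycle:
  assumes "total_two_cycle G b x"
  shows "stability_index G \<ge> 0"
proof -
  let ?f = "parallel_map G b"
  have xV: "x i \<in> {-1, 1}" if "i \<in> V" for i
    using assms that by (auto simp: total_two_cycle_def configs_def dest: PiE_mem)
  have fV: "?f x i = - x i" if "i \<in> V" for i
    using assms xV[OF that] that parallel_map_eq[OF that, of b x]
    by (auto simp: total_two_cycle_def Let_def split: if_splits)
  \<comment> \<open>A vertex exactly at its threshold would keep its state, so both updates are
    strict: with input s, both x_i (s - b_i) and x_i (s + b_i) are negative. Adding them cancels
    b_i, and integrality gives the bound -1.\<close>
  have neg: "x i * (\<Sum>j\<in>V. w i j * x j) \<le> -1" if i: "i \<in> V" for i
  proof -
    have "?f (?f x) i = x i" using assms by (simp add: total_two_cycle_def)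
    moreover have "(\<Sum>j\<in>V. w i j * ?f x j) = - (\<Sum>j\<in>V. w i j * x j)"
      using fV by (simp add: sum_negf)
    ultimately show ?thesis
      using fV[OF i] xV[OF i] parallel_map_eq[OF i, of b x] parallel_map_eq[OF i, of b "?f x"]
      by (auto simp: Let_def split: if_splits)
  qed
  \<comment> \<open>Outside \<open>V\<close> the configuration is \<open>undefined\<close>, whereas
    \<open>quadratic_form\<close> and \<open>rho_le\<close> ask for values -1 or 1
    everywhere.\<close>
  define y where "y = (\<lambda>v. if v \<in> V then x v else 1)"
  have y: "y v \<in> {-1, 1}" for v using xV by (auto simp: y_def)
  have "(\<Sum>i\<in>V. \<Sum>j\<in>V. y i * w i j * y j) = (\<Sum>i\<in>V. x i * (\<Sum>j\<in>V. w i j * x j))"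
    by (auto simp: y_def sum_distrib_left mult.assoc intro!: sum.cong)
  also have "\<dots> \<le> (\<Sum>i\<in>V. -1)" by (rule sum_mono) (rule neg)
  finally have "(\<Sum>i\<in>V. \<Sum>j\<in>V. y i * w i j * y j) \<le> - int (card V)" by simp
  then show ?thesis
    using quadratic_form[of y, OF y] rho_le[of y, OF y] by (simp add: stability_index_def)
qed

lemma two_cycle_if_negative_rows:
  fixes x :: "'v \<Rightarrow> int"
  assumes S: "S \<subseteq> V" "S \<noteq> {}" and x: "\<And>v. x v \<in> {-1, 1}"
    and neg: "\<And>i. i \<in> S \<Longrightarrow> (\<Sum>j\<in>S. x i * w i j * x j) < 0"
  shows "\<exists>b y. attractor G b 2 y"
proof -
  define b where "b i = (if i \<in> S then \<Sum>j\<in>V - S. w i j * x j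
    else - x i * (1 + (\<Sum>j\<in>V. \<bar>w i j\<bar>)))" for i
  \<comment> \<open>The factor \<open>c\<close> is the phase of the blinking part; one update turns
    it into \<open>- c\<close>.\<close>
  define y where "y c = (\<lambda>i\<in>V. if i \<in> S then c * x i else x i)" for c :: int
  have yV: "y c i \<in> {-1, 1}" if "c \<in> {-1, 1}" "i \<in> V" for c i
    using that x[of i] by (auto simp: y_def)
  have step: "parallel_map G b (y c) = y (- c)" if c: "c \<in> {-1, 1}" for c
  proof
    fix i
    show "parallel_map G b (y c) i = y (- c) i"
    proof (cases "i \<in> V")
      case False
      then show ?thesis by (simp add: parallel_map_def y_def)
    next
      case i: True
      show ?thesis
      proof (cases "i \<in> S")
        case True
        let ?r = "\<Sum>j\<in>S. w i j * x j"
        have r: "x i * ?r < 0"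
          using neg[OF True] by (simp add: sum_distrib_left mult.assoc)
        have "(\<Sum>j\<in>V. w i j * y c j) = (\<Sum>j\<in>V - S. w i j * y c j) + (\<Sum>j\<in>S. w i j * y c j)"
          by (rule sum.subset_diff[OF S(1) finV])
        also have "(\<Sum>j\<in>V - S. w i j * y c j) = b i"
          using True by (auto simp: b_def y_def intro!: sum.cong)
        also have "(\<Sum>j\<in>S. w i j * y c j) = c * ?r"
          using S(1) by (auto simp: y_def sum_distrib_left intro!: sum.cong)
        finally have "(\<Sum>j\<in>V. w i j * y c j) - b i = c * ?r" by simp
        \<comment> \<open>Since \<open>?r\<close> has the sign opposite to \<open>x i\<close>, the
          net input \<open>c * ?r\<close> reverses the state \<open>c * x i\<close>.\<close>
        then show ?thesis
          using r c x[of i] True i by (auto simp: parallel_map_eq Let_def y_def)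
      next
        case False
        have "\<bar>\<Sum>j\<in>V. w i j * y c j\<bar> \<le> (\<Sum>j\<in>V. \<bar>w i j * y c j\<bar>)" by (rule sum_abs)
        also have "\<dots> \<le> (\<Sum>j\<in>V. \<bar>w i j\<bar>)"
          using yV[OF c] by (intro sum_mono) (fastforce simp: abs_mult)
        finally show ?thesis
          using False i x[of i] by (auto simp: parallel_map_eq Let_def b_def y_def)
      qed
    qed
  qed
  obtain i where i: "i \<in> S" using S by blast
  have "y (-1) i \<noteq> y 1 i" using i S x[of i] by (auto simp: y_def)
  then have "y (-1) \<noteq> y 1" by auto
  then have "parallel_map G b (y 1) \<noteq> y 1" by (simp add: step)
  moreover have "y 1 \<in> configs G"
    using yV[of 1] by (auto simp: configs_def PiE_def extensional_def y_def)
  moreover have "parallel_map G b (parallel_map G b (y 1)) = y 1" by (simp add: step)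
  moreover have "q = 1" if "1 \<le> q" "q < 2" for q :: nat using that by simp
  ultimately have "attractor G b 2 (y 1)"
    by (auto simp: attractor_def numeral_2_eq_2 less_Suc_eq)
  then show ?thesis by blast
qed

text \<open>Nonemptiness of \<open>V\<close> matters: without vertices the index is 0, but the
  single configuration is a fixed point.\<close>

lemma two_cycle_if_stability:
  assumes "V \<noteq> {}" "stability_index G \<ge> 0"
  shows "\<exists>b y. attractor G b 2 y"
proof -
  obtain x :: "'v \<Rightarrow> int" where x: "\<And>v. x v \<in> {-1, 1}"
    and X: "card {e \<in> E. z e * prod x e = 1} \<le> rho G"
    using rho_attained by blast
  let ?a = "\<lambda>i j. x i * w i j * x j"
  have "(\<Sum>i\<in>V. \<Sum>j\<in>V. ?a i j) \<le> - int (card V)"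
    using quadratic_form[of x, OF x] X assms by (simp add: stability_index_def)
  moreover have "?a i j = ?a j i" for i j using w_sym[of i j] by simp
  moreover have "?a i i \<le> 1" for i using x[of i] w_le_1[of i i] by auto
  ultimately obtain S where "S \<subseteq> V" "S \<noteq> {}" "\<forall>i\<in>S. (\<Sum>j\<in>S. ?a i j) < 0"
    using negative_row_subset[of V ?a] finV assms by blast
  then show ?thesis using two_cycle_if_negative_rows[of S x] x by blast
qed

end

theorem theorem4:
  fixes G :: "'v sgraph"
  assumes "signed_graph G"
  shows "((\<exists>b :: 'v \<Rightarrow> int. \<exists>x. total_two_cycle G b x) \<longrightarrow> stability_index G \<ge> 0) \<and>
         (verts G \<noteq> {} \<and> stability_index G \<ge> 0 \<longrightarrow> (\<exists>b :: 'v \<Rightarrow> int. \<exists>x. attractor G b 2 x))"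
  using stability_if_total_two_cycle[OF assms] two_cycle_if_stability[OF assms] by blast

end
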